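(* The convergence rate of any continuous-time optimization algorithm $(g,h)\in\mathcal{G}'$ ($k\ge2$) whose characteristic polynomial has bounded roots cannot exceed $\mathcal{O}(1/\sqrt\kappa)$. Precisely: for every integer $k\ge2$ and every $B>0$ there is a constant $C>0$ (depending only on $k$ and $B$) such that the following holds for all $0<\mu\le L$ with $\kappa:=L/\mu$. Let $(g,h)\in\mathcal{G}'$ be an algorithm of order $k$ for $C_{\mu,L}$ with normalized first-order approximation $$x^{(k)}=-\sum_{j=1}^{k-1}g_jx^{(j)}-\frac1L\,\Delta f(0)\Big(x+\sum_{j=1}^{k-1}h_jx^{(j)}\Big),\qquad g_j,h_j\in\mathbb{R},$$ and suppose that for every $\lambda_f\in[1/\kappa,1]$ all complex roots $s$ of the characteristic polynomial $$s^k+(g_{k-1}+h_{k-1}\lambda_f)s^{k-1}+\dots+(g_1+h_1\lambda_f)s+\lambda_f=0$$ satisfy $|s|\le B$. Then the convergence rate of $(g,h)$ on $C_{\mu,L}$ is at most $C/\sqrt\kappa$.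
   Context: Function class. Let $n\geq 1$ and $0<\mu\le L$. $C_{\mu,L}$ is a class of functions $f:\mathbb{R}^n\to\mathbb{R}$ with Lipschitz-continuous gradient, having a local minimum at $x=0$ with $f(0)=0$, such that: (C1) each $f\in C_{\mu,L}$ is twice continuously differentiable in a neighborhood of the origin; (C2) for every $f\in C_{\mu,L}$ the spectrum of the Hessian at the origin, denoted $\Delta f(0)$, is contained in $[\mu,L]$, and conversely for every $\lambda\in[\mu,L]$ there is $f\in C_{\mu,L}$ with $\lambda\in\mathrm{spec}(\Delta f(0))$; (C3) $f\in C_{\mu,L}$ implies $f\circ T\in C_{\mu,L}$ for every orthogonal $T\in O(n)$. Algorithms. For an integer $k\geq 1$, an algorithm is a pair $(g,h)$, with $g:\mathbb{R}^{n\times k}\times\mathbb{R}^n\to\mathbb{R}^n$ and $h:\mathbb{R}^{n\times k}\to\mathbb{R}^n$ independent of $f$, defining the dynamics $$x^{(k)}(t)=g\big(x^{(k-1)}(t),\dots,\dot x(t),x(t),\nabla f[h(x(t),\dot x(t),\dots,x^{(k-1)}(t))]\big),$$ where $x^{(p)}$ is the $p$-th time derivative. $(g,h)\in\mathcal{G}$ means that for all $f\in C_{\mu,L}$: (G1) $g,h$ are continuously differentiable in all arguments; (G2) critical points of $f$ correspond to equilibria of the dynamics; (G3) local minima of $f$ correspond to asymptotically stable (in the sense of Lyapunov) equilibria of the dynamics. Time normalization. Writing $g=g(w,v)$ with $w\in\mathbb{R}^{n\times k}$ and $v\in\mathbb{R}^n$ the last (gradient) argument, $$\mathcal{G}':=\Big\{(g,h)\in\mathcal{G}\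 \Big|\ \det\Big(\frac{\partial g(w,v)}{\partial v}\Big|_{0,0}\,\frac{\partial h}{\partial x}\Big|_{0}\Big)=(-1/L)^n\Big\}.$$ First-order approximation. This is the linearization of the dynamics at the origin. By the paper's convention it is taken in the orthogonally invariant form displayed in the claim: the derivative of $h$ with respect to $x$ at the origin is normalized to the identity, the other coefficient matrices are scalar multiples $g_jI$, $h_jI$ of the identity, and the coefficient of the gradient term is $1/L$ by the time normalization. The number $\lambda_f\in[1/\kappa,1]$ stands for an eigenvalue of $\Delta f(0)/L$. Convergence rate. With $z=(x,\dot x,\dots,x^{(k-1)})$, the convergence rate of the dynamics for a given $f$ is the supremum of all $a\ge0$ for which there are a neighborhood $N$ of the origin and a constant $c\ge1$ with $|z(t)|\le c|z(0)|e^{-at}$ for all $t\ge0$ and all $z(0)\in N$. For a linear system this is the negative of the largest real part of the roots of its characteristic polynomial. The convergence rate on $C_{\mu,L}$ is the worst case (infimum) over $f\in C_{\mu,L}$. *)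

theory Defs
  imports
    "HOL-Analysis.Analysis"
    "Jordan_Normal_Form.Spectral_Radius"
begin

hide_const (open) Determinants.det

section \<open>Euclidean spaces with a set of coordinates as a parameter\<close>

text \<open>
  The dimension n is quantified inside the theorem (the constant must not depend on it), so
  \<real>^I is a set of real families that vanish outside of the index set I.
  For finite I the product topology of the function type induces the Euclidean topology on it.
\<close>

definition coords :: "'i set \<Rightarrow> ('i \<Rightarrow> real) set" where
  "coords I = {x. \<forall>i. i \<notin> I \<longrightarrow> x i = 0}"

definition vnorm :: "'i set \<Rightarrow> ('i \<Rightarrow> real) \<Rightarrow> real" where
  "vnorm I x = L2_set x I"

definition vdist :: "'i set \<Rightarrow> ('i \<Rightarrow> real) \<Rightarrow> ('i \<Rightarrow> real) \<Rightarrow> real" where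
  "vdist I x y = vnorm I (\<lambda>i. x i - y i)"

definition partial_deriv :: "'i \<Rightarrow> (('i \<Rightarrow> real) \<Rightarrow> real) \<Rightarrow> ('i \<Rightarrow> real) \<Rightarrow> real" where
  "partial_deriv i F x = deriv (\<lambda>t. F (x(i := t))) (x i)"

text \<open>Continuous differentiability on a relatively open subset S of \<real>^I.\<close>

definition cont_diff_on :: "'i set \<Rightarrow> ('i \<Rightarrow> real) set \<Rightarrow> (('i \<Rightarrow> real) \<Rightarrow> real) \<Rightarrow> bool" where
  "cont_diff_on I S F \<longleftrightarrow>
     (\<forall>i\<in>I. (\<forall>x\<in>S. (\<lambda>t. F (x(i := t))) differentiable (at (x i)))
          \<and> continuous_on S (partial_deriv i F))"

abbreviation Rn :: "nat \<Rightarrow> (nat \<Rightarrow> real) set" where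
  "Rn n \<equiv> coords {..<n}"

definition mat_app :: "real mat \<Rightarrow> (nat \<Rightarrow> real) \<Rightarrow> nat \<Rightarrow> real" where
  "mat_app A x = (\<lambda>i. if i < dim_row A then \<Sum>l<dim_col A. A $$ (i, l) * x l else 0)"

definition gradient :: "nat \<Rightarrow> ((nat \<Rightarrow> real) \<Rightarrow> real) \<Rightarrow> (nat \<Rightarrow> real) \<Rightarrow> nat \<Rightarrow> real" where
  "gradient n f x = (\<lambda>i. if i < n then partial_deriv i f x else 0)"

definition hessian :: "nat \<Rightarrow> ((nat \<Rightarrow> real) \<Rightarrow> real) \<Rightarrow> (nat \<Rightarrow> real) \<Rightarrow> real mat" where
  "hessian n f x = mat n n (\<lambda>(i, l). partial_deriv i (partial_deriv l f) x)"

definition jacobian ::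
  "nat \<Rightarrow> ((nat \<Rightarrow> real) \<Rightarrow> nat \<Rightarrow> real) \<Rightarrow> (nat \<Rightarrow> real) \<Rightarrow> real mat" where
  "jacobian n F x = mat n n (\<lambda>(i, l). partial_deriv l (\<lambda>y. F y i) x)"

definition orthogonal_group :: "nat \<Rightarrow> real mat set" where
  "orthogonal_group n = {Q \<in> carrier_mat n n. transpose_mat Q * Q = 1\<^sub>m n}"


section \<open>The function class\<close>

definition critical_point :: "nat \<Rightarrow> ((nat \<Rightarrow> real) \<Rightarrow> real) \<Rightarrow> (nat \<Rightarrow> real) \<Rightarrow> bool" where
  "critical_point n f x \<longleftrightarrow> gradient n f x = (\<lambda>_. 0)"

definition local_min :: "nat \<Rightarrow> ((nat \<Rightarrow> real) \<Rightarrow> real) \<Rightarrow> (nat \<Rightarrow> real) \<Rightarrow> bool" where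
  "local_min n f x \<longleftrightarrow> (\<exists>r>0. \<forall>y \<in> Rn n. vdist {..<n} y x < r \<longrightarrow> f x \<le> f y)"

definition lipschitz_gradient :: "nat \<Rightarrow> ((nat \<Rightarrow> real) \<Rightarrow> real) \<Rightarrow> bool" where
  "lipschitz_gradient n f \<longleftrightarrow> cont_diff_on {..<n} (Rn n) f \<and>
     (\<exists>K. \<forall>x \<in> Rn n. \<forall>y \<in> Rn n.
        vdist {..<n} (gradient n f x) (gradient n f y) \<le> K * vdist {..<n} x y)"

definition C2_near_origin :: "nat \<Rightarrow> ((nat \<Rightarrow> real) \<Rightarrow> real) \<Rightarrow> bool" where
  "C2_near_origin n f \<longleftrightarrow> (\<exists>r>0.
     let U = {x \<in> Rn n. vnorm {..<n} x < r} in
       cont_diff_on {..<n} U f \<and> (\<forall>i<n. cont_diff_on {..<n} U (partial_deriv i f)))"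

text \<open>
  A function on \<real>^n is represented extensionally (undefined outside of Rn n).
  The Hessians are symmetric, so their spectrum is the set of their real eigenvalues.
\<close>

definition function_class ::
  "nat \<Rightarrow> real \<Rightarrow> real \<Rightarrow> ((nat \<Rightarrow> real) \<Rightarrow> real) set \<Rightarrow> bool" where
  "function_class n \<mu> L \<F> \<longleftrightarrow>
     (\<forall>f\<in>\<F>. f \<in> Rn n \<rightarrow>\<^sub>E UNIV \<and> lipschitz_gradient n f \<and>
        local_min n f (\<lambda>_. 0) \<and> f (\<lambda>_. 0) = 0 \<and> C2_near_origin n f \<and>
        spectrum (hessian n f (\<lambda>_. 0)) \<subseteq> {\<mu>..L}) \<and>
     (\<forall>l\<in>{\<mu>..L}. \<exists>f\<in>\<F>. l \<in> spectrum (hessian n f (\<lambda>_. 0))) \<and>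
     (\<forall>f\<in>\<F>. \<forall>Q\<in>orthogonal_group n. compose (Rn n) f (mat_app Q) \<in> \<F>)"


section \<open>Dynamics of order k\<close>

text \<open>
  A state z = (x, x', ..., x^(k-1)) has coordinates z (j, i), the i-th component of the j-th
  time derivative of x.  The dynamics x^(k) = F(z) is written as the equivalent first-order system
  for z on the half-line t \<ge> 0.
\<close>

type_synonym state = "nat \<times> nat \<Rightarrow> real"
type_synonym field = "state \<Rightarrow> nat \<Rightarrow> real"

abbreviation state_ix :: "nat \<Rightarrow> nat \<Rightarrow> (nat \<times> nat) set" where
  "state_ix n k \<equiv> {..<k} \<times> {..<n}"

abbreviation states :: "nat \<Rightarrow> nat \<Rightarrow> state set" where
  "states n k \<equiv> coords (state_ix n k)"

definition at_rest :: "(nat \<Rightarrow> real) \<Rightarrow> state" where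
  "at_rest x = (\<lambda>(j, i). if j = 0 then x i else 0)"

definition is_solution :: "nat \<Rightarrow> nat \<Rightarrow> field \<Rightarrow> (real \<Rightarrow> state) \<Rightarrow> bool" where
  "is_solution n k F z \<longleftrightarrow> (\<forall>t\<ge>0. z t \<in> states n k \<and>
     (\<forall>i<n. (\<forall>j. Suc j < k \<longrightarrow>
          ((\<lambda>\<tau>. z \<tau> (j, i)) has_real_derivative z t (Suc j, i)) (at t within {0..})) \<and>
        ((\<lambda>\<tau>. z \<tau> (k - 1, i)) has_real_derivative F (z t) i) (at t within {0..})))"

definition equilibrium :: "nat \<Rightarrow> nat \<Rightarrow> field \<Rightarrow> state \<Rightarrow> bool" where
  "equilibrium n k F e \<longleftrightarrow> is_solution n k F (\<lambda>_. e)"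

text \<open>Asymptotic stability and the exponential bound include that solutions exist for all t \<ge> 0.\<close>

definition solvable_from :: "nat \<Rightarrow> nat \<Rightarrow> field \<Rightarrow> state \<Rightarrow> bool" where
  "solvable_from n k F z0 \<longleftrightarrow> (\<exists>z. is_solution n k F z \<and> z 0 = z0)"

definition asymptotically_stable :: "nat \<Rightarrow> nat \<Rightarrow> field \<Rightarrow> state \<Rightarrow> bool" where
  "asymptotically_stable n k F e \<longleftrightarrow> equilibrium n k F e \<and>
     (\<forall>\<epsilon>>0. \<exists>\<delta>>0. \<forall>z0 \<in> states n k. vdist (state_ix n k) z0 e < \<delta> \<longrightarrow>
        solvable_from n k F z0 \<and>
        (\<forall>z. is_solution n k F z \<and> z 0 = z0 \<longrightarrow>
           (\<forall>t\<ge>0. vdist (state_ix n k) (z t) e < \<epsilon>))) \<and>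
     (\<exists>\<delta>>0. \<forall>z. is_solution n k F z \<and> vdist (state_ix n k) (z 0) e < \<delta> \<longrightarrow>
        ((\<lambda>t. vdist (state_ix n k) (z t) e) \<longlongrightarrow> 0) at_top)"

definition exp_bound :: "nat \<Rightarrow> nat \<Rightarrow> field \<Rightarrow> real \<Rightarrow> bool" where
  "exp_bound n k F a \<longleftrightarrow> (\<exists>r>0. \<exists>c\<ge>1. \<forall>z0 \<in> states n k. vnorm (state_ix n k) z0 < r \<longrightarrow>
     solvable_from n k F z0 \<and>
     (\<forall>z. is_solution n k F z \<and> z 0 = z0 \<longrightarrow>
        (\<forall>t\<ge>0. vnorm (state_ix n k) (z t) \<le> c * vnorm (state_ix n k) z0 * exp (- a * t))))"

definition conv_rate :: "nat \<Rightarrow> nat \<Rightarrow> field \<Rightarrow> ereal" where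
  "conv_rate n k F = Sup (ereal ` {a. a \<ge> 0 \<and> exp_bound n k F a})"


section \<open>Algorithms\<close>

type_synonym alg = "(state \<Rightarrow> (nat \<Rightarrow> real) \<Rightarrow> nat \<Rightarrow> real) \<times> (state \<Rightarrow> nat \<Rightarrow> real)"

definition closed_loop :: "nat \<Rightarrow> alg \<Rightarrow> ((nat \<Rightarrow> real) \<Rightarrow> real) \<Rightarrow> field" where
  "closed_loop n alg f = (\<lambda>z. fst alg z (gradient n f (snd alg z)))"

definition conv_rate_on :: "nat \<Rightarrow> nat \<Rightarrow> ((nat \<Rightarrow> real) \<Rightarrow> real) set \<Rightarrow> alg \<Rightarrow> ereal" where
  "conv_rate_on n k \<F> alg = (INF f\<in>\<F>. conv_rate n k (closed_loop n alg f))"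

text \<open>The arguments (w, v) of g are joined into one family indexed by a disjoint sum.\<close>

definition algorithms :: "nat \<Rightarrow> nat \<Rightarrow> ((nat \<Rightarrow> real) \<Rightarrow> real) set \<Rightarrow> alg set" where
  "algorithms n k \<F> = {(g, h).
     g \<in> states n k \<rightarrow> Rn n \<rightarrow> Rn n \<and> h \<in> states n k \<rightarrow> Rn n \<and>
     (\<forall>i<n. let J = state_ix n k <+> {..<n} in
        cont_diff_on J (coords J) (\<lambda>u. g (u \<circ> Inl) (u \<circ> Inr) i)) \<and>
     (\<forall>i<n. cont_diff_on (state_ix n k) (states n k) (\<lambda>w. h w i)) \<and>
     (\<forall>f\<in>\<F>. \<forall>x \<in> Rn n.
        critical_point n f x \<longleftrightarrow> equilibrium n k (closed_loop n (g, h) f) (at_rest x)) \<and>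
     (\<forall>f\<in>\<F>. \<forall>x \<in> Rn n.
        local_min n f x \<longleftrightarrow> asymptotically_stable n k (closed_loop n (g, h) f) (at_rest x))}"

definition normalized_algorithms ::
  "nat \<Rightarrow> nat \<Rightarrow> real \<Rightarrow> ((nat \<Rightarrow> real) \<Rightarrow> real) set \<Rightarrow> alg set" where
  "normalized_algorithms n k L \<F> = {(g, h) \<in> algorithms n k \<F>.
     Determinant.det (jacobian n (g (\<lambda>_. 0)) (\<lambda>_. 0) *
                      jacobian n (\<lambda>x. h (at_rest x)) (\<lambda>_. 0)) = (- 1 / L) ^ n}"

text \<open>A is the (Frechet) derivative of F at the origin.\<close>

definition linearization :: "nat \<Rightarrow> nat \<Rightarrow> field \<Rightarrow> field \<Rightarrow> bool" where
  "linearization n k F A \<longleftrightarrow> (\<forall>\<epsilon>>0. \<exists>\<delta>>0. \<forall>z \<in> states n k. vnorm (state_ix n k) z < \<delta> \<longrightarrow>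
     vnorm {..<n} (\<lambda>i. F z i - F (\<lambda>_. 0) i - A z i) \<le> \<epsilon> * vnorm (state_ix n k) z)"

definition normal_form ::
  "nat \<Rightarrow> real \<Rightarrow> (nat \<Rightarrow> real) \<Rightarrow> (nat \<Rightarrow> real) \<Rightarrow> real mat \<Rightarrow> field" where
  "normal_form k L gc hc H = (\<lambda>z i.
     - (\<Sum>j=1..k-1. gc j * z (j, i))
     - 1 / L * mat_app H (\<lambda>l. z (0, l) + (\<Sum>j=1..k-1. hc j * z (j, l))) i)"

definition has_normal_form ::
  "nat \<Rightarrow> nat \<Rightarrow> real \<Rightarrow> ((nat \<Rightarrow> real) \<Rightarrow> real) set \<Rightarrow> alg \<Rightarrow> (nat \<Rightarrow> real) \<Rightarrow> (nat \<Rightarrow> real) \<Rightarrow> bool" where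
  "has_normal_form n k L \<F> alg gc hc \<longleftrightarrow>
     (\<forall>f\<in>\<F>. linearization n k (closed_loop n alg f)
              (normal_form k L gc hc (hessian n f (\<lambda>_. 0))))"

definition char_fun :: "nat \<Rightarrow> (nat \<Rightarrow> real) \<Rightarrow> (nat \<Rightarrow> real) \<Rightarrow> real \<Rightarrow> complex \<Rightarrow> complex" where
  "char_fun k gc hc l s =
     s ^ k + (\<Sum>j=1..k-1. of_real (gc j + hc j * l) * s ^ j) + of_real l"

end

theory Submission
  imports Defs
begin

text \<open>
  An exponential bound with rate a for the nonlinear dynamics forces Re s \<le> - a for every root s of
  the characteristic polynomial at every eigenvalue of the Hessian: project a trajectory onto the
  left eigenvector of the linearization belonging to s.  The projection solves w' = s w + r, where r
  is small relative to the distance from the origin, so exp (- s t) w barely moves; but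
  it tends to 0 if Re s > - a.

  It remains to bound the common decay rate a of the roots s of p = a_0 + a_1 s + a_2 s^2 + \<dots>,
  where a_0 = \<lambda> and the a_j are affine in \<lambda>.  The numbers r = - 1 / s satisfy
  Re r \<ge> 0, so \<Sum> |r|^2 \<le> (a_1 / \<lambda>)^2 + 2 a_2 / \<lambda>, while \<Prod> |r| = 1 / \<lambda>.
  At \<lambda> = 1 / \<kappa> we have |r| \<le> 1 / a; at \<lambda> = 1 the product of the roots has modulus 1 and
  |s| \<le> B, so |r| \<le> B^(k-1).  Interpolating the resulting bounds on a_1 and a_2 at
  \<lambda> = 1 / (\<kappa> a^2) bounds all |r| there in terms of k and B, hence also their product \<kappa> a^2.
\<close>

section \<open>Reciprocals of the roots\<close>

definition char_poly_alg :: "nat \<Rightarrow> (nat \<Rightarrow> real) \<Rightarrow> (nat \<Rightarrow> real) \<Rightarrow> real \<Rightarrow> complex poly" where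
  "char_poly_alg k gc hc l =
     monom 1 k + (\<Sum>j=1..k-1. monom (of_real (gc j + hc j * l)) j) + [:of_real l:]"

lemma poly_char_poly_alg: "poly (char_poly_alg k gc hc l) s = char_fun k gc hc l s"
  by (simp add: char_poly_alg_def char_fun_def poly_sum poly_monom)

lemma coeff_char_poly_alg:
  assumes "k \<ge> 1"
  shows "coeff (char_poly_alg k gc hc l) m =
    (if m = 0 then of_real l else if m < k then of_real (gc m + hc m * l) else if m = k then 1 else 0)"
proof -
  have "(\<Sum>j=1..k-1. coeff (monom (of_real (gc j + hc j * l)) j) m :: complex) =
      (\<Sum>j=1..k-1. if j = m then of_real (gc j + hc j * l) else 0)"
    by (rule sum.cong) auto
  then show ?thesis
    using assms by (auto simp: char_poly_alg_def coeff_sum coeff_pCons split: nat.splits)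
qed

lemma degree_char_poly_alg:
  assumes "k \<ge> 1"
  shows "degree (char_poly_alg k gc hc l) = k"
proof (rule antisym)
  show "degree (char_poly_alg k gc hc l) \<le> k"
    using assms by (intro degree_le) (auto simp: coeff_char_poly_alg)
  show "k \<le> degree (char_poly_alg k gc hc l)"
    using assms by (intro le_degree) (auto simp: coeff_char_poly_alg)
qed

text \<open>Vieta's formulas, with Newton's identity for the sum of squares. One induction serves
  all three, because each coefficient of a longer product needs the next lower coefficient of the
  shorter one.\<close>

lemma coeff_1_prod_linear: "coeff (\<Prod>r\<leftarrow>rs. [:1, r:]) 1 = sum_list (rs :: complex list)"
  and coeff_2_prod_linear: "(sum_list rs)\<^sup>2 - 2 * coeff (\<Prod>r\<leftarrow>rs. [:1, r:]) 2 = (\<Sum>r\<leftarrow>rs. r\<^sup>2)"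
  and coeff_0_prod_linear: "coeff (\<Prod>r\<leftarrow>rs. [:1, r:]) 0 = 1"
proof (induction rs)
  case (Cons r rs)
  let ?P = "\<Prod>r\<leftarrow>rs. [:1, r:]"
  have m: "[:1, r:] * ?P = ?P + pCons 0 (Polynomial.smult r ?P)" by simp
  { case 1 then show ?case using Cons by (simp add: m)
  next
    case 2
    have "coeff ([:1, r:] * ?P) 2 = coeff ?P 2 + r * sum_list rs"
      using Cons by (simp add: m numeral_2_eq_2)
    then show ?case using Cons(2)
      by (simp add: power2_eq_square algebra_simps)
  next
    case 3 then show ?case using Cons by (simp add: m) }
qed auto

text \<open>Each monic factor \<open>[:- a, 1:]\<close> is \<open>- a\<close> times
  \<open>[:1, - 1 / a:]\<close>. The nonzero constant coefficient keeps 0 from being a root, and it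
  equals the product of the extracted factors \<open>- a\<close>.\<close>

lemma reversed_factorization:
  fixes p :: "complex poly"
  assumes "lead_coeff p = 1" "coeff p 0 \<noteq> 0"
  obtains rs where "length rs = degree p" "p = Polynomial.smult (coeff p 0) (\<Prod>r\<leftarrow>rs. [:1, r:])"
    "\<forall>r\<in>set rs. r \<noteq> 0 \<and> poly p (- 1 / r) = 0"
proof -
  obtain as where as: "p = (\<Prod>a\<leftarrow>as. [:- a, 1:])" "length as = degree p"
    using fundamental_theorem_algebra_factorized[of p] assms(1) by auto
  have roots: "a \<noteq> 0 \<and> poly p a = 0" if "a \<in> set as" for a
  proof
    show "poly p a = 0"
      using that by (auto simp: as(1) poly_prod_list prod_list_zero_iff image_iff)
    then show "a \<noteq> 0" using assms(2) by (auto simp: poly_0_coeff_0)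
  qed
  have "\<forall>a\<in>set as. a \<noteq> 0 \<Longrightarrow> (\<Prod>a\<leftarrow>as. [:- a, 1:]) =
      Polynomial.smult (\<Prod>a\<leftarrow>as. - a) (\<Prod>a\<leftarrow>as. [:1, - 1 / a:])" for as :: "complex list"
  proof (induction as)
    case (Cons a as)
    have "[:- a, 1:] = Polynomial.smult (- a) [:1, - 1 / a:]" using Cons.prems by simp
    then show ?case
      using Cons by (simp only: list.map prod_list.Cons mult_smult_left mult_smult_right smult_smult) simp
  qed simp
  then have p: "p = Polynomial.smult (\<Prod>a\<leftarrow>as. - a) (\<Prod>r\<leftarrow>map (\<lambda>a. - 1 / a) as. [:1, r:])"
    using roots as(1) by (simp add: o_def)
  have "(\<Prod>a\<leftarrow>as. - a) = coeff p 0"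
    by (subst p) (simp only: coeff_smult coeff_0_prod_linear mult_1_right)
  then show thesis
    using p as(2) roots by (intro that[of "map (\<lambda>a. - 1 / a) as"]) auto
qed

lemma lead_coeff_prod_linear:
  "coeff (\<Prod>r\<leftarrow>rs. [:1, r:]) (length rs) = prod_list (rs :: complex list)"
proof (induction rs)
  case (Cons r rs)
  have "degree (\<Prod>r\<leftarrow>rs. [:1, r:]) \<le> length rs"
    by (induction rs) (auto intro!: order.trans[OF degree_mult_le] order.trans[OF degree_add_le_max] simp: degree_pCons_eq_if)
  then show ?case using Cons by (simp add: coeff_eq_0)
qed simp

text \<open>
  The left-hand side is 2 \<Sum> (Re r)^2 - Re \<Sum> r^2, and no cross term of (\<Sum> Re r)^2 is negative.
\<close>

lemma sum_norm_square_le: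
  fixes rs :: "complex list"
  assumes "\<forall>r\<in>set rs. Re r \<ge> 0"
  shows "(\<Sum>r\<leftarrow>rs. (norm r)\<^sup>2) \<le> 2 * (Re (sum_list rs))\<^sup>2 - Re (\<Sum>r\<leftarrow>rs. r\<^sup>2)"
  using assms
proof (induction rs)
  case (Cons r rs)
  have "Re (sum_list rs) \<ge> 0" using Cons.prems by (induction rs) auto
  then have "Re r * Re (sum_list rs) \<ge> 0" using Cons.prems by simp
  then show ?case using Cons
cmod_power2[of r]
    by (simp add: power2_eq_square algebra_simps)
qed simp

section \<open>Bounds on sums and products of lists\<close>

lemma norm_sum_list_le:
  fixes rs :: "'a::real_normed_vector list"
  assumes "\<forall>r\<in>set rs. norm r \<le> R"
  shows "norm (sum_list rs) \<le> real (length rs) * R"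
  using assms by (induction rs) (auto intro!: order.trans[OF norm_triangle_ineq] simp: algebra_simps)

lemma norm_prod_list_le:
  fixes rs :: "'a::real_normed_field list"
  assumes "\<forall>r\<in>set rs. norm r \<le> R"
  shows "norm (prod_list rs) \<le> R ^ length rs"
  using assms
  by (induction rs) (auto simp: norm_mult intro!: mult_mono intro: order.trans[OF norm_ge_zero])


text \<open>Every other factor has modulus at least \<open>1 / B\<close>, so removing them from the
  product costs at most one factor \<open>B\<close> each.\<close>

lemma norm_le_norm_prod_list:
  fixes rs :: "'a::real_normed_field list"
  assumes "\<forall>r\<in>set rs. 1 \<le> norm r * B" "B > 0" "r \<in> set rs"
  shows "norm r \<le> norm (prod_list rs) * B ^ (length rs - 1)"
proof -
  have lower: "1 \<le> norm (prod_list xs) * B ^ length xs" if "\<forall>x\<in>set xs. 1 \<le> norm x * B" for xs :: "'a list"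
    using that
  proof (induction xs)
    case (Cons x xs)
    then have "1 * 1 \<le> (norm x * B) * (norm (prod_list xs) * B ^ length xs)"
      using assms(2) by (intro mult_mono) auto
    then show ?case by (simp add: norm_mult mult_ac)
  qed simp
  obtain xs ys where rs: "rs = xs @ r # ys" using split_list[OF assms(3)] by blast
  have "norm r * 1 \<le> norm r * (norm (prod_list (xs @ ys)) * B ^ length (xs @ ys))"
    using assms(1) by (intro mult_left_mono lower) (auto simp: rs)
  then show ?thesis by (simp add: rs norm_mult mult_ac)
qed

section \<open>Interpolation in \<lambda> and the bound on the decay rate\<close>

lemma affine_le_of_endpoints:
  fixes \<alpha> \<beta> m x U V :: real
  assumes "0 \<le> m" "m < 1" "m \<le> x" "x \<le> 1" "\<alpha> + \<beta> * m \<le> U" "\<alpha> + \<beta> \<le> V" "0 \<le> U" "0 \<le> V"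
  shows "\<alpha> + \<beta> * x \<le> U + x * V"
proof -
  \<comment> \<open>\<open>x\<close> is the convex combination of \<open>m\<close> and 1 with weight
    \<open>\<theta>\<close> on 1. That \<open>\<theta> \<le> x\<close>, and not just
    \<open>\<theta> \<le> 1\<close>, is what matters: the bound \<open>V\<close> then enters with a
    factor \<open>x\<close>, which cancels when coefficients are later divided by \<lambda>.\<close>
  define \<theta> where "\<theta> = (x - m) / (1 - m)"
  have \<theta>: "0 \<le> \<theta>" "\<theta> \<le> 1" using assms by (auto simp: \<theta>_def)
  have "x - m \<le> x * (1 - m)" using assms mult_left_mono[of x 1 m] by (simp add: algebra_simps)
  then have "\<theta> \<le> x" using assms by (simp add: \<theta>_def divide_le_eq)
  have "\<theta> * (1 - m) = x - m" using assms by (simp add: \<theta>_def)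
  then have x: "x = m + \<theta> - \<theta> * m" by (simp add: algebra_simps)
  then have "\<alpha> + \<beta> * x = (1 - \<theta>) * (\<alpha> + \<beta> * m) + \<theta> * (\<alpha> + \<beta>)"
    by (subst x) (simp add: algebra_simps)
  also have "\<dots> \<le> (1 - \<theta>) * U + \<theta> * V"
    using \<theta> assms by (intro add_mono mult_left_mono) auto
  also have "\<dots> \<le> 1 * U + x * V"
    using \<theta> \<open>\<theta> \<le> x\<close> assms by (intro add_mono mult_right_mono) auto
  finally show ?thesis by simp
qed

text \<open>The second coefficient of the characteristic polynomial is the leading one if k = 2.\<close>

lemma char_fun_inverse_roots:
  assumes "k \<ge> 2" "l > 0"
  obtains rs where "length rs = k" "\<forall>r\<in>set rs. r \<noteq> 0 \<and> char_fun k gc hc l (- 1 / r) = 0"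
    "of_real l * prod_list rs = 1"
    "sum_list rs = of_real ((gc 1 + hc 1 * l) / l)"
    "(\<Sum>r\<leftarrow>rs. r\<^sup>2) = of_real (((gc 1 + hc 1 * l) / l)\<^sup>2
       - 2 * (if k = 2 then 1 else gc 2 + hc 2 * l) / l)"
proof -
  define p where "p = char_poly_alg k gc hc l"
  have k: "k \<ge> 1" using assms by simp
  note co = coeff_char_poly_alg[OF k, of gc hc l, folded p_def]
  have deg: "degree p = k" using degree_char_poly_alg[OF k] by (simp add: p_def)
  obtain rs where rs: "length rs = k" "p = Polynomial.smult (of_real l) (\<Prod>r\<leftarrow>rs. [:1, r:])"
      "\<forall>r\<in>set rs. r \<noteq> 0 \<and> poly p (- 1 / r) = 0"
    using reversed_factorization[of p] assms by (auto simp: co deg)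
  have co': "coeff p m = of_real l * coeff (\<Prod>r\<leftarrow>rs. [:1, r:]) m" for m
    by (subst rs(2)) simp
  have 1: "sum_list rs = of_real ((gc 1 + hc 1 * l) / l)"
    using co'[of 1] coeff_1_prod_linear[of rs] assms by (simp add: co field_simps)
  have "of_real l * coeff (\<Prod>r\<leftarrow>rs. [:1, r:]) 2 =
      complex_of_real (if k = 2 then 1 else gc 2 + hc 2 * l)"
    using assms by (simp add: co'[symmetric] co)
  then have "coeff (\<Prod>r\<leftarrow>rs. [:1, r:]) 2 =
      complex_of_real ((if k = 2 then 1 else gc 2 + hc 2 * l) / l)"
    using assms by (simp add: field_simps)
  then have 2: "(\<Sum>r\<leftarrow>rs. r\<^sup>2) = of_real (((gc 1 + hc 1 * l) / l)\<^sup>2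
       - 2 * (if k = 2 then 1 else gc 2 + hc 2 * l) / l)"
    unfolding coeff_2_prod_linear[of rs, symmetric] 1 by simp
  have 3: "of_real l * prod_list rs = 1"
    using co'[of k] lead_coeff_prod_linear[of rs] assms by (simp add: co rs(1))
  show thesis
    using that[OF rs(1) _ 3 1 2] rs(3) by (simp add: p_def poly_char_poly_alg)
qed

text \<open>The two summands of \<open>D\<close> bound \<open>(A1 l / l)\<^sup>2\<close> and
  \<open>2 * A2 l / l\<close> at the interpolation point \<open>l\<close>, so that \<open>D\<close>
  bounds the sum of the squared moduli of the reciprocals there.\<close>

lemma decay_rate_bound:
  fixes B \<kappa> a :: real and k :: nat
  defines "D \<equiv> (real k * (1 + B ^ (k - 1)))\<^sup>2 + (real k ^ 2 + real k) * (1 + (B ^ (k - 1))\<^sup>2)"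
  assumes k: "k \<ge> 2" and B: "B > 0" and \<kappa>: "\<kappa> \<ge> 1" and a: "a > 0"
    and roots: "\<And>l s. l \<in> {1 / \<kappa>..1} \<Longrightarrow> char_fun k gc hc l s = 0 \<Longrightarrow> norm s \<le> B \<and> Re s \<le> - a"
  shows "\<kappa> * a\<^sup>2 \<le> D ^ k"
proof -
  \<comment> \<open>If all reciprocals have modulus at most \<open>R\<close>, then
    \<open>2 * A2 l / l\<close>, the square of their sum minus the sum of their squares, is at most
    \<open>(k * R)\<^sup>2 + k * R\<^sup>2 = K * R\<^sup>2\<close>.\<close>
  define K where "K = real k ^ 2 + real k"
  define B' where "B' = B ^ (k - 1)"
  define A1 A2 where "A1 = (\<lambda>l. gc 1 + hc 1 * l)" and "A2 = (\<lambda>l. if k = 2 then 1 else gc 2 + hc 2 * l)"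
  have K: "K \<ge> 1" unfolding K_def using k by (simp add: add_increasing)
  have B': "B' > 0" using B by (simp add: B'_def)
  have D: "D = (real k * (1 + B'))\<^sup>2 + K * (1 + B'\<^sup>2)" by (simp add: D_def K_def B'_def)
  have "1 * 1 \<le> K * (1 + B'\<^sup>2)" using K by (intro mult_mono) auto
  then have D1: "D \<ge> 1" unfolding D by (simp add: add_increasing)
  have ex: "\<exists>rs. length rs = k \<and> (\<forall>r\<in>set rs. Re r \<ge> 0 \<and> norm r \<le> 1 / a \<and> 1 \<le> norm r * B) \<and>
      norm (prod_list rs) = 1 / l \<and> sum_list rs = of_real (A1 l / l) \<and>
      (\<Sum>r\<leftarrow>rs. r\<^sup>2) = of_real ((A1 l / l)\<^sup>2 - 2 * A2 l / l)" if l: "l \<in> {1 / \<kappa>..1}" for l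
  proof -
    have "0 < 1 / \<kappa>" using \<kappa> by simp
    then have "l > 0" using l by (meson atLeastAtMost_iff less_le_trans)
    obtain rs where rs: "length rs = k" "\<forall>r\<in>set rs. r \<noteq> 0 \<and> char_fun k gc hc l (- 1 / r) = 0"
        "of_real l * prod_list rs = 1" "sum_list rs = of_real (A1 l / l)"
        "(\<Sum>r\<leftarrow>rs. r\<^sup>2) = of_real ((A1 l / l)\<^sup>2 - 2 * A2 l / l)"
      using char_fun_inverse_roots[OF k \<open>l > 0\<close>, of gc hc] unfolding A1_def A2_def by blast
    \<comment> \<open>With \<open>s = - 1 / r\<close>, the half-plane condition gives the sign of
      \<open>Re r\<close> and also \<open>a \<le> norm s\<close>, hence the upper bound on
      \<open>norm r\<close>; the lower bound is \<open>norm s \<le> B\<close>.\<close>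
    have "Re r \<ge> 0 \<and> norm r \<le> 1 / a \<and> 1 \<le> norm r * B" if "r \<in> set rs" for r
    proof -
      have r: "r \<noteq> 0" "norm (- 1 / r) \<le> B" "Re (- 1 / r) \<le> - a"
        using rs(2) roots[OF l] that by blast+
      have "Re (- 1 / r) = - (Re r / (norm r)\<^sup>2)" by (simp add: Re_divide cmod_power2)
      then have "Re r / (norm r)\<^sup>2 > 0" using r(3) a by simp
      then have "Re r \<ge> 0" by (simp add: zero_less_divide_iff)
      moreover have "a \<le> 1 / norm r"
        using r(3) abs_Re_le_cmod[of "- 1 / r"] by (simp add: norm_divide)
      then have "norm r \<le> 1 / a" using a r(1) by (simp add: field_simps)
      moreover have "1 \<le> norm r * B" using r by (simp add: norm_divide field_simps)
      ultimately show ?thesis by blast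
    qed
    moreover have "norm (prod_list rs) = 1 / l"
      using arg_cong[OF rs(3), of norm] \<open>l > 0\<close> by (simp add: norm_mult field_simps)
    ultimately show ?thesis using rs by blast
  qed
  \<comment> \<open>Used at both ends of the interval: with \<open>R = 1 / a\<close> at
    \<open>1 / \<kappa>\<close>, and with \<open>R = B'\<close> at 1.\<close>
  have coeff_le: "A1 l \<le> l * (real k * R)" "2 * A2 l \<le> l * (K * R\<^sup>2)"
    if rs: "length rs = k" "\<forall>r\<in>set rs. norm r \<le> R" "sum_list rs = complex_of_real (A1 l / l)"
      "(\<Sum>r\<leftarrow>rs. r\<^sup>2) = complex_of_real ((A1 l / l)\<^sup>2 - 2 * A2 l / l)" and l: "l > 0" for l R rs
  proof -
    have e1: "\<bar>A1 l / l\<bar> \<le> real k * R"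
      using norm_sum_list_le[OF rs(2)] by (simp only: rs(1,3) norm_of_real)
    then have "A1 l / l \<le> real k * R" by linarith
    then show "A1 l \<le> l * (real k * R)" using l by (simp add: field_simps)
    have "\<forall>x\<in>set (map (\<lambda>r. r\<^sup>2) rs). norm x \<le> R\<^sup>2"
      using rs(2) by (auto simp: norm_power intro!: power_mono)
    from norm_sum_list_le[OF this]
    have "\<bar>(A1 l / l)\<^sup>2 - 2 * A2 l / l\<bar> \<le> real k * R\<^sup>2" by (simp only: rs(4) norm_of_real length_map rs(1))
    moreover have "(A1 l / l)\<^sup>2 \<le> (real k * R)\<^sup>2"
      using power_mono[OF e1, of 2] by (simp only: power2_abs abs_ge_zero)
    ultimately have "2 * A2 l / l \<le> K * R\<^sup>2"
      by (simp add: K_def power_mult_distrib algebra_simps)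
    then show "2 * A2 l \<le> l * (K * R\<^sup>2)" using l by (simp add: field_simps)
  qed
  have k\<kappa>: "1 / \<kappa> \<in> {1 / \<kappa>..1}" "1 \<in> {1 / \<kappa>..1}" using \<kappa> by auto
  obtain rs0 where rs0: "length rs0 = k" "\<forall>r\<in>set rs0. norm r \<le> 1 / a"
      "sum_list rs0 = complex_of_real (A1 (1 / \<kappa>) / (1 / \<kappa>))"
      "(\<Sum>r\<leftarrow>rs0. r\<^sup>2) = complex_of_real ((A1 (1 / \<kappa>) / (1 / \<kappa>))\<^sup>2 - 2 * A2 (1 / \<kappa>) / (1 / \<kappa>))"
    using ex[OF k\<kappa>(1)] by blast
  have c0: "A1 (1 / \<kappa>) \<le> 1 / \<kappa> * (real k * (1 / a))" "2 * A2 (1 / \<kappa>) \<le> 1 / \<kappa> * (K * (1 / a)\<^sup>2)"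
    using coeff_le[OF rs0] \<kappa> by auto
  obtain rs1 where rs1: "length rs1 = k" "\<forall>r\<in>set rs1. norm r \<le> 1 / a \<and> 1 \<le> norm r * B"
      "norm (prod_list rs1) = 1 / 1"
      "sum_list rs1 = complex_of_real (A1 1 / 1)"
      "(\<Sum>r\<leftarrow>rs1. r\<^sup>2) = complex_of_real ((A1 1 / 1)\<^sup>2 - 2 * A2 1 / 1)"
    using ex[OF k\<kappa>(2)] by blast
  have "\<forall>r\<in>set rs1. norm r \<le> B'"
    using norm_le_norm_prod_list[of rs1 B] rs1 B by (auto simp: B'_def)
  from coeff_le[OF rs1(1) this rs1(4,5)]
  have c1: "A1 1 \<le> real k * B'" "2 * A2 1 \<le> K * B'\<^sup>2" by auto
  \<comment> \<open>At \<lambda> = 1 the product of the reciprocals has modulus 1 while each factor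
    is at most \<open>1 / a\<close>. This forces \<open>a \<le> 1\<close>.\<close>
  have "1 \<le> (1 / a) ^ k"
    using norm_prod_list_le[of rs1 "1 / a"] rs1 by simp
  then have "\<not> 1 < a ^ k" using a by (simp add: power_divide)
  then have "a \<le> 1"
    using k by (meson not_le_imp_less one_less_power pos2 less_le_trans)
  show ?thesis
  \<comment> \<open>The first case is trivial because \<open>D \<ge> 1\<close>. In the second, the
    interpolation point lies in the admissible interval: it is at most 1 by the case assumption and
    at least \<open>1 / \<kappa>\<close> because \<open>a \<le> 1\<close>.\<close>
  proof (cases "\<kappa> * a\<^sup>2 \<le> 1")
    case True
    then show ?thesis using one_le_power[OF D1, of k] by linarith
  next
    case False
    \<comment> \<open>At this point the endpoint bound \<open>K / (\<kappa> * a\<^sup>2)\<close> on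
      the second coefficient is exactly \<open>l * K\<close>, and the bound
      \<open>k / (\<kappa> * a)\<close> on the first is \<open>l * k * a\<close>. Both are thus of
      order \<open>l\<close>.\<close>
    define l where "l = 1 / (\<kappa> * a\<^sup>2)"
    have "a\<^sup>2 \<le> 1" using a \<open>a \<le> 1\<close> by (simp add: power_le_one)
    then have "\<kappa> * a\<^sup>2 \<le> \<kappa> * 1" using \<kappa> by (intro mult_left_mono) auto
    then have "\<kappa> > 1" using False by linarith
    have l: "l \<in> {1 / \<kappa>..1}" "l > 0"
      using False a \<kappa> \<open>\<kappa> * a\<^sup>2 \<le> \<kappa> * 1\<close> unfolding l_def by (auto intro!: divide_left_mono simp del: mult_1_right)
    have A1l: "A1 l \<le> l * (real k * (1 + B'))"
    proof -
      have "A1 l \<le> 1 / \<kappa> * (real k * (1 / a)) + l * (real k * B')"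
        unfolding A1_def
        by (rule affine_le_of_endpoints[where m = "1 / \<kappa>"]) (use c0 c1 l \<open>\<kappa> > 1\<close> a B' in \<open>auto simp: A1_def\<close>)
      also have "1 / \<kappa> * (real k * (1 / a)) = l * (real k * a)"
        using a \<kappa> by (simp add: l_def field_simps power2_eq_square)
      also have "\<dots> \<le> l * (real k * 1)"
        using l \<open>a \<le> 1\<close> by (intro mult_left_mono) auto
      finally show ?thesis by (simp add: algebra_simps)
    qed
    have A2l: "2 * A2 l \<le> l * (K * (1 + B'\<^sup>2))"
    proof -
      \<comment> \<open>For \<open>k = 2\<close> the coefficient is constantly 1, hence still
        affine, with slope 0.\<close>
      obtain \<alpha> \<beta> where \<alpha>\<beta>: "\<And>x. 2 * A2 x = \<alpha> + \<beta> * x"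
      proof (cases "k = 2")
        case True
        then show thesis using that[of 2 0] by (simp add: A2_def)
      next
        case False
        then show thesis using that[of "2 * gc 2" "2 * hc 2"] by (simp add: A2_def algebra_simps)
      qed
      have "2 * A2 l \<le> 1 / \<kappa> * (K * (1 / a)\<^sup>2) + l * (K * B'\<^sup>2)"
        unfolding \<alpha>\<beta>
        by (rule affine_le_of_endpoints[where m = "1 / \<kappa>"])
          (use c0(2)[unfolded \<alpha>\<beta>] c1(2)[unfolded \<alpha>\<beta>] l \<open>\<kappa> > 1\<close> a B' K in auto)
      also have "1 / \<kappa> * (K * (1 / a)\<^sup>2) = l * K"
        using a \<kappa> by (simp add: l_def field_simps power2_eq_square)
      finally show ?thesis by (simp add: algebra_simps)
    qed
    obtain rs where rs: "length rs = k" "\<forall>r\<in>set rs. Re r \<ge> 0"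
      "norm (prod_list rs) = 1 / l" "sum_list rs = complex_of_real (A1 l / l)"
      "(\<Sum>r\<leftarrow>rs. r\<^sup>2) = complex_of_real ((A1 l / l)\<^sup>2 - 2 * A2 l / l)"
      using ex[OF l(1)] by blast
    \<comment> \<open>Interpolation bounds \<open>A1 l / l\<close> only from above; nonnegativity
      allows the bound to be squared.\<close>
    have "Re (sum_list rs) \<ge> 0" using rs(2) by (induction rs) auto
    then have "0 \<le> A1 l / l" by (simp only: rs(4) Re_complex_of_real)
    moreover have "A1 l / l \<le> real k * (1 + B')" using A1l l by (simp add: field_simps)
    ultimately have e1: "(A1 l / l)\<^sup>2 \<le> (real k * (1 + B'))\<^sup>2" by (rule power_mono[rotated])
    have e2: "2 * A2 l / l \<le> K * (1 + B'\<^sup>2)" using A2l l by (simp add: field_simps)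
    have S: "(\<Sum>r\<leftarrow>rs. (norm r)\<^sup>2) \<le> D"
      using sum_norm_square_le[OF rs(2)] e1 e2 unfolding rs(4,5) Re_complex_of_real D by linarith
    have "norm r \<le> D" if "r \<in> set rs" for r
    proof -
      have "(norm r)\<^sup>2 \<le> (\<Sum>r\<leftarrow>rs. (norm r)\<^sup>2)"
        using that by (intro member_le_sum_list) auto
      also have "\<dots> \<le> D\<^sup>2" using S D1 self_le_power[of D 2] by simp
      finally show ?thesis using D1 by (simp add: abs_le_square_iff[symmetric])
    qed
    then have "norm (prod_list rs) \<le> D ^ k" using norm_prod_list_le[of rs D] rs(1) by auto
    then show ?thesis by (simp add: rs(3) l_def)
  qed
qed

section \<open>From nonlinear decay to the spectrum of the linearization\<close>

text \<open>A matrix and its transpose have the same characteristic polynomial, so \<open>l\<close>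
  is an eigenvalue of the transpose, whose eigenvectors are the left eigenvectors of
  \<open>H\<close>.\<close>

lemma left_eigenvector:
  fixes H :: "real mat"
  assumes "H \<in> carrier_mat n n" "l \<in> spectrum H"
  obtains u where "\<exists>i<n. u i \<noteq> 0" "\<And>m. m < n \<Longrightarrow> (\<Sum>i<n. u i * H $$ (i, m)) = l * u m"
proof -
  have "eigenvalue (transpose_mat H) l"
    using assms by (simp add: spectrum_def eigenvalue_root_char_poly[of _ n])
  then obtain v where v: "v \<in> carrier_vec n" "v \<noteq> 0\<^sub>v n" "transpose_mat H *\<^sub>v v = l \<cdot>\<^sub>v v"
    using assms(1) by (auto simp: eigenvalue_def eigenvector_def)
  have "(\<Sum>i<n. v $ i * H $$ (i, m)) = l * v $ m" if "m < n" for m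
    using arg_cong[OF v(3), of "\<lambda>w. w $ m"] that v(1) assms(1)
    by (simp add: scalar_prod_def atLeast0LessThan mult.commute)
  moreover have "\<exists>i<n. v $ i \<noteq> 0"
  proof (rule ccontr)
    assume "\<not> (\<exists>i<n. v $ i \<noteq> 0)"
    then have "v = 0\<^sub>v n" using v(1) by (intro eq_vecI) auto
    then show False using v(2) by simp
  qed
  ultimately show thesis using that[of "\<lambda>i. v $ i"] by blast
qed

text \<open>Compares exp (- s t) w(t) at t = 0 with its limit 0 at infinity.\<close>

lemma norm_initial_le_of_perturbed_decay:
  fixes w :: "real \<Rightarrow> complex"
  assumes "a + Re s > 0"
    and w': "\<And>t. t \<ge> 0 \<Longrightarrow> (w has_vector_derivative s * w t + r t) (at t within {0..})"
    and r: "\<And>t. t \<ge> 0 \<Longrightarrow> norm (r t) \<le> M * exp (- a * t)"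
    and w: "\<And>t. t \<ge> 0 \<Longrightarrow> norm (w t) \<le> K * exp (- a * t)"
  shows "norm (w 0) \<le> M / (a + Re s)"
proof -
  define \<sigma> where "\<sigma> = a + Re s"
  have \<sigma>: "\<sigma> > 0" using assms(1) by (simp add: \<sigma>_def)
  define v where "v = (\<lambda>t. exp (- (of_real t * s)) * w t)"
  have norm_exp: "norm (exp (- (of_real t * s))) * exp (- a * t) = exp (- \<sigma> * t)" for t
    unfolding norm_exp_eq_Re \<sigma>_def by (simp add: algebra_simps exp_add[symmetric])
  have E: "((\<lambda>t. exp (- (of_real t * s))) has_vector_derivative - s * exp (- (of_real t * s))) (at t within S)" for t S
    by (rule has_vector_derivative_real_field[of "\<lambda>z. exp (- (z * s))"])
       (auto intro!: derivative_eq_intros)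
  have v': "(v has_vector_derivative exp (- (of_real t * s)) * r t) (at t within {0..})" if "t \<ge> 0" for t
    unfolding v_def
    by (rule has_vector_derivative_eq_rhs[OF has_vector_derivative_mult[OF E w'[OF that]]])
       (simp add: algebra_simps)
  have M: "M \<ge> 0" using order.trans[OF norm_ge_zero r[of 0]] by simp
  have bound: "norm (v T - v 0) \<le> M / \<sigma>" if "T > 0" for T
  proof -
    \<comment> \<open>The derivative of \<open>v\<close> is at most
      \<open>M * exp (- \<sigma> * t)\<close> in norm. The comparison function is an antiderivative
      of this bound and grows by at most \<open>M / \<sigma>\<close> in total.\<close>
    have "norm (v T - v 0) \<le> - (M / \<sigma>) * exp (- \<sigma> * T) - (- (M / \<sigma>) * exp (- \<sigma> * 0))"
    proof (rule differentiable_bound_general[OF that, where f' = "\<lambda>t. exp (- (of_real t * s)) * r t"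
          and \<phi>' = "\<lambda>t. M * exp (- \<sigma> * t)"])
      have "continuous_on {0..} v"
        unfolding continuous_on_eq_continuous_within
        using has_vector_derivative_continuous[OF v'] by (metis atLeast_iff)
      then show "continuous_on {0..T} v"
        by (rule continuous_on_subset) auto
      show "continuous_on {0..T} (\<lambda>t. - (M / \<sigma>) * exp (- \<sigma> * t))"
        by (intro continuous_intros)
      fix t assume t: "0 < t" "t < T"
      have at: "at t within {0..} = at t"
        by (rule at_within_interior) (simp add: t interior_real_atLeast)
      show "(v has_vector_derivative exp (- (of_real t * s)) * r t) (at t)"
        using v'[of t] t unfolding at by simp
      show "((\<lambda>t. - (M / \<sigma>) * exp (- \<sigma> * t)) has_vector_derivative M * exp (- \<sigma> * t)) (at t)"
        unfolding has_real_derivative_iff_has_vector_derivative[symmetric]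
        using \<sigma> by (auto intro!: derivative_eq_intros simp: field_simps)
      have "norm (exp (- (of_real t * s)) * r t) \<le> norm (exp (- (of_real t * s))) * (M * exp (- a * t))"
        unfolding norm_mult by (rule mult_left_mono[OF r]) (use t in simp_all)
      also have "\<dots> = M * exp (- \<sigma> * t)" unfolding norm_exp[of t, symmetric] by (simp only: mult_ac)
      finally show "norm (exp (- (of_real t * s)) * r t) \<le> M * exp (- \<sigma> * t)" .
    qed
    also have "\<dots> \<le> M / \<sigma>" using M \<sigma> by simp
    finally show ?thesis .
  qed
  have "(v \<longlongrightarrow> 0) at_top"
  proof (rule Lim_null_comparison)
    show "\<forall>\<^sub>F t in at_top. norm (v t) \<le> K * exp (- \<sigma> * t)"
      using eventually_ge_at_top[of 0]
    proof eventually_elim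
      case (elim t)
      have "norm (v t) \<le> norm (exp (- (of_real t * s))) * (K * exp (- a * t))"
        unfolding norm_mult v_def using w[of t] elim by (intro mult_left_mono) auto
      then show ?case using norm_exp[of t] by (simp add: mult_ac)
    qed
    have "((\<lambda>t. exp (- \<sigma> * t)) \<longlongrightarrow> 0) at_top"
      by (rule filterlim_compose[OF exp_at_bot filterlim_tendsto_neg_mult_at_bot[OF tendsto_const _ filterlim_ident]])
        (use \<sigma> in simp)
    then show "((\<lambda>t. K * exp (- \<sigma> * t)) \<longlongrightarrow> 0) at_top"
      by (rule tendsto_mult_right_zero)
  qed
  then have "((\<lambda>t. norm (v t - v 0)) \<longlongrightarrow> norm (0 - v 0)) at_top"
    by (intro tendsto_intros)
  then have "norm (0 - v 0) \<le> M / \<sigma>"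
    by (rule tendsto_upperbound[OF _ eventually_mono[OF eventually_gt_at_top[of 0] bound]]) simp_all
  then show ?thesis by (simp add: v_def \<sigma>_def)
qed


text \<open>Pairing with a left eigenvector replaces \<open>H\<close> by the number
  \<open>l\<close>. What remains is a scalar equation of order \<open>k\<close> whose coefficients
  are those of the characteristic polynomial at \<lambda> = \<open>l / L\<close>.\<close>

lemma normal_form_left_eigenvector:
  fixes u :: "nat \<Rightarrow> real"
  assumes "k \<ge> 1" "H \<in> carrier_mat n n" and u: "\<And>m. m < n \<Longrightarrow> (\<Sum>i<n. u i * H $$ (i, m)) = l * u m"
  shows "(\<Sum>i<n. u i * normal_form k L gc hc H z i) =
    - (\<Sum>j<k. (if j = 0 then l / L else gc j + hc j * (l / L)) * (\<Sum>i<n. u i * z (j, i)))"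
proof -
  define y where "y = (\<lambda>j. \<Sum>i<n. u i * z (j, i))"
  define x where "x = (\<lambda>m. z (0, m) + (\<Sum>j=1..k-1. hc j * z (j, m)))"
  have comb: "(\<Sum>i<n. u i * (\<Sum>j=1..k-1. b j * z (j, i))) = (\<Sum>j=1..k-1. b j * y j)" for b
    unfolding y_def sum_distrib_left by (subst sum.swap) (simp add: mult_ac)
  have "(\<Sum>i<n. u i * mat_app H x i) = (\<Sum>i<n. \<Sum>m<n. u i * H $$ (i, m) * x m)"
    using assms(2) by (simp add: mat_app_def sum_distrib_left mult_ac)
  also have "\<dots> = (\<Sum>m<n. (\<Sum>i<n. u i * H $$ (i, m)) * x m)"
    by (subst sum.swap) (simp add: sum_distrib_right)
  also have "\<dots> = l * (\<Sum>m<n. u m * x m)"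
    by (simp add: u sum_distrib_left mult_ac)
  also have "(\<Sum>m<n. u m * x m) = y 0 + (\<Sum>j=1..k-1. hc j * y j)"
    unfolding x_def distrib_left sum.distrib comb by (simp add: y_def)
  finally have H: "(\<Sum>i<n. u i * mat_app H x i) = l * (y 0 + (\<Sum>j=1..k-1. hc j * y j))" .
  have "(\<Sum>i<n. u i * normal_form k L gc hc H z i) =
      - (\<Sum>i<n. u i * (\<Sum>j=1..k-1. gc j * z (j, i))) - 1 / L * (\<Sum>i<n. u i * mat_app H x i)"
    by (simp add: normal_form_def x_def right_diff_distrib sum_subtractf sum_negf sum_divide_distrib)
  also have "\<dots> = - (l / L * y 0 + (\<Sum>j=1..k-1. (gc j + hc j * (l / L)) * y j))"
    unfolding comb H by (simp add: ring_distribs sum.distrib sum_distrib_left mult_ac add_divide_distrib)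
  also have "l / L * y 0 + (\<Sum>j=1..k-1. (gc j + hc j * (l / L)) * y j) =
      (\<Sum>j<k. (if j = 0 then l / L else gc j + hc j * (l / L)) * y j)"
  proof -
    have "{..<k} = insert 0 {1..k-1}" using assms(1) by auto
    then show ?thesis by simp
  qed
  finally show ?thesis by (simp add: y_def)
qed

section \<open>Trajectories and their projections\<close>

lemma is_solution_derivatives:
  assumes "is_solution n (Suc k) F z" "t \<ge> 0"
  shows "j < k \<Longrightarrow> ((\<lambda>\<tau>. \<Sum>i<n. u i * z \<tau> (j, i)) has_real_derivative (\<Sum>i<n. u i * z t (Suc j, i))) (at t within {0..})"
    and "((\<lambda>\<tau>. \<Sum>i<n. u i * z \<tau> (k, i)) has_real_derivative (\<Sum>i<n. u i * F (z t) i)) (at t within {0..})"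
  using assms unfolding is_solution_def has_real_derivative_iff_has_vector_derivative
  by (intro has_vector_derivative_sum has_vector_derivative_mult_right; simp)+

text \<open>From the zero state the bound leaves only the zero trajectory, whose highest component
  has derivative \<open>F 0\<close>. This is needed because \<open>linearization\<close>
  approximates only the difference of \<open>F\<close> and its value at the origin.\<close>

lemma exp_bound_imp_field_zero:
  assumes "k \<ge> 1" "exp_bound n k F a" "i < n"
  shows "F (\<lambda>_. 0) i = 0"
proof -
  obtain r c where rc: "r > 0" "\<And>z0. z0 \<in> states n k \<Longrightarrow> vnorm (state_ix n k) z0 < r \<Longrightarrow>
     solvable_from n k F z0 \<and>
     (\<forall>z. is_solution n k F z \<and> z 0 = z0 \<longrightarrow>
        (\<forall>t\<ge>0. vnorm (state_ix n k) (z t) \<le> c * vnorm (state_ix n k) z0 * exp (- a * t)))"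
    using assms(2) unfolding exp_bound_def by blast
  have 0: "vnorm (state_ix n k) (\<lambda>_. 0) = 0" by (simp add: vnorm_def L2_set_def)
  obtain z where z: "is_solution n k F z" "z 0 = (\<lambda>_. 0)"
      "\<forall>t\<ge>0. vnorm (state_ix n k) (z t) \<le> 0"
    using rc(2)[of "\<lambda>_. 0"] rc(1) unfolding solvable_from_def 0 by (auto simp: coords_def)
  have "z t (k - 1, i) = 0" if "t \<ge> 0" for t
  proof -
    have "vnorm (state_ix n k) (z t) = 0"
      using z(3) that by (intro antisym) (auto simp: vnorm_def)
    then show ?thesis using assms(1,3) by (simp add: vnorm_def L2_set_eq_0_iff)
  qed
  moreover have D: "((\<lambda>\<tau>. z \<tau> (k - 1, i)) has_real_derivative F (z 0) i) (at 0 within {0..})"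
    using z(1) assms(3) unfolding is_solution_def by auto
  ultimately have "((\<lambda>\<tau>. 0) has_real_derivative F (z 0) i) (at 0 within {0..})"
    by (intro has_field_derivative_transform_within[OF D, of 1]) simp_all
  moreover have "((\<lambda>\<tau>. 0) has_real_derivative 0) (at (0::real) within {0..})" by simp
  moreover have "at (0::real) within {0..} \<noteq> bot"
    by (simp add: at_within_Ici_at_right)
  ultimately show ?thesis
    unfolding z(2) by (rule has_field_derivative_unique)
qed

text \<open>If \<open>Re s > - a\<close>, a small initial state is chosen whose projection
  \<open>w 0\<close> is twice as large as the perturbation estimate permits.\<close>

lemma exp_bound_imp_Re_root_le:
  assumes k: "k \<ge> 1" and a: "a \<ge> 0" and H: "H \<in> carrier_mat n n" "l \<in> spectrum H"
    and bound: "exp_bound n k F a"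
    and lin: "linearization n k F (normal_form k L gc hc H)"
    and root: "char_fun k gc hc (l / L) s = 0"
  shows "Re s \<le> - a"
proof (rule ccontr)
  assume "\<not> Re s \<le> - a"
  define \<sigma> where "\<sigma> = a + Re s"
  have \<sigma>: "\<sigma> > 0" using \<open>\<not> Re s \<le> - a\<close> by (simp add: \<sigma>_def)
  define I where "I = state_ix n k"
  obtain k' where k': "k = Suc k'" using k by (cases k) auto
  obtain r c where r: "r > 0" and c: "c \<ge> 1" and sol: "\<And>z0. z0 \<in> states n k \<Longrightarrow> vnorm I z0 < r \<Longrightarrow>
     solvable_from n k F z0 \<and>
     (\<forall>z. is_solution n k F z \<and> z 0 = z0 \<longrightarrow>
        (\<forall>t\<ge>0. vnorm I (z t) \<le> c * vnorm I z0 * exp (- a * t)))"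
    using bound unfolding exp_bound_def I_def by blast
  obtain u where u: "\<exists>i<n. u i \<noteq> 0" "\<And>m. m < n \<Longrightarrow> (\<Sum>i<n. u i * H $$ (i, m)) = l * u m"
    using left_eigenvector[OF H] by blast
  define N where "N = vnorm {..<n} u"
  have N: "N > 0"
    using u(1) L2_set_nonneg[of u "{..<n}"] by (auto simp: N_def vnorm_def L2_set_eq_0_iff less_le)
  have N2: "N * N = (\<Sum>i<n. u i * u i)"
    by (simp add: N_def vnorm_def L2_set_def sum_nonneg power2_eq_square)
  define A where "A = normal_form k L gc hc H"
  \<comment> \<open>Chosen so that the final estimate
    \<open>N * (\<eta> * (c * (\<epsilon> * N))) / \<sigma>\<close> is half of
    \<open>\<epsilon> * (N * N)\<close>, the size of \<open>w 0\<close>.\<close>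
  define \<eta> where "\<eta> = \<sigma> / (2 * c)"
  have \<eta>: "\<eta> > 0" using \<sigma> c by (simp add: \<eta>_def)
  obtain \<delta> where \<delta>: "\<delta> > 0" and rem: "\<And>z. z \<in> states n k \<Longrightarrow> vnorm I z < \<delta> \<Longrightarrow>
     vnorm {..<n} (\<lambda>i. F z i - F (\<lambda>_. 0) i - A z i) \<le> \<eta> * vnorm I z"
    using lin \<eta> unfolding linearization_def A_def I_def by blast
  \<comment> \<open>Small enough that the exponential bound applies to the initial state and that
    the trajectory, at most \<open>c\<close> times larger, stays where the linearization error is
    controlled.\<close>
  define \<epsilon> where "\<epsilon> = min \<delta> r / (2 * c * N)"
  have \<epsilon>: "\<epsilon> > 0" using \<delta> r c N by (simp add: \<epsilon>_def)
  have c\<epsilon>N: "c * (\<epsilon> * N) = min \<delta> r / 2" using c N by (simp add: \<epsilon>_def)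
  have "1 * (\<epsilon> * N) \<le> c * (\<epsilon> * N)" using c \<epsilon> N by (intro mult_right_mono) auto
  then have \<epsilon>N: "\<epsilon> * N < r" "c * (\<epsilon> * N) < \<delta>" using c\<epsilon>N \<delta> r by auto
  \<comment> \<open>Only the highest derivative, of index \<open>k' = k - 1\<close>, is excited. As
    \<open>q\<close> is monic of degree \<open>k'\<close>, the projection starts at exactly
    \<open>\<epsilon> * (N * N)\<close>.\<close>
  define z0 where "z0 = (\<lambda>(j, i). if j = k' \<and> i < n then \<epsilon> * u i else 0)"
  have z0: "z0 \<in> states n k" by (auto simp: coords_def z0_def k')
  have "(\<Sum>x\<in>I. (z0 x)\<^sup>2) = (\<Sum>j<k. \<Sum>i<n. (z0 (j, i))\<^sup>2)"
    unfolding I_def by (simp add: sum.cartesian_product)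
  also have "\<dots> = (\<Sum>i<n. (\<epsilon> * u i)\<^sup>2)" by (simp add: k' z0_def)
  finally have "vnorm I z0 = L2_set (\<lambda>i. \<epsilon> * u i) {..<n}" by (simp add: vnorm_def L2_set_def)
  then have norm_z0: "vnorm I z0 = \<epsilon> * N"
    using \<epsilon> by (simp add: N_def vnorm_def L2_set_right_distrib)
  obtain z where z: "is_solution n k F z" "z 0 = z0"
    using sol[OF z0] \<epsilon>N(1) unfolding norm_z0 solvable_from_def by blast
  have zb: "vnorm I (z t) \<le> c * (\<epsilon> * N) * exp (- a * t)" if "t \<ge> 0" for t
    using sol[OF z0] \<epsilon>N(1) z that unfolding norm_z0 by blast
  have zs: "z t \<in> states n k" if "t \<ge> 0" for t
    using z(1) that unfolding is_solution_def by blast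
  have F0: "F (\<lambda>_. 0) i = 0" if "i < n" for i
    using exp_bound_imp_field_zero[OF k bound that] .

  define b where "b = (\<lambda>j. if j = 0 then l / L else gc j + hc j * (l / L))"
  define p where "p = char_poly_alg k gc hc (l / L)"
  have co: "coeff p j = of_real (b j)" if "j < k" for j
    using that by (simp add: p_def coeff_char_poly_alg[OF k] b_def)
  have "poly p s = 0" using root by (simp add: p_def poly_char_poly_alg)
  \<comment> \<open>The coefficients of q form the left eigenvector for s of the companion matrix of p.\<close>
  then obtain q where q: "p = [:- s, 1:] * q" by (auto simp: poly_eq_0_iff_dvd)
  have "p \<noteq> 0" using degree_char_poly_alg[OF k, of gc hc "l / L"] k by (auto simp: p_def)
  then have "q \<noteq> 0" using q by auto
  then have "degree p = degree q + 1" unfolding q by (subst degree_mult_eq) auto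
  then have "degree q = k'" using degree_char_poly_alg[OF k, of gc hc "l / L"] by (simp add: p_def k')
  then have q_k: "coeff q k = 0" by (simp add: k' coeff_eq_0)
  have q_0: "s * coeff q 0 = - of_real (b 0)"
  proof -
    have "- (s * coeff q 0) = of_real (b 0)" using co[of 0] k by (simp add: q)
    then show ?thesis by (metis minus_minus)
  qed
  have q_Suc: "s * coeff q (Suc j) = coeff q j - of_real (b (Suc j))" if "Suc j < k" for j
    using co[OF that] by (simp add: q algebra_simps)
  have "coeff p k = 1" using k by (simp add: p_def coeff_char_poly_alg)
  then have q_k': "coeff q k' = 1"
    using q_k by (simp add: q k')

  define y where "y = (\<lambda>j t. \<Sum>i<n. u i * z t (j, i))"
  define \<rho> where "\<rho> = (\<lambda>t. \<Sum>i<n. u i * (F (z t) i - A (z t) i))"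
  define w where "w = (\<lambda>t. \<Sum>j<k. coeff q j * complex_of_real (y j t))"
  have y': "(y j has_real_derivative y (Suc j) t) (at t within {0..})" if "j < k'" "t \<ge> 0" for j t
    using is_solution_derivatives(1)[OF z(1)[unfolded k'] that(2,1)] by (simp add: y_def)
  have "(\<Sum>i<n. u i * F (z t) i) = (\<Sum>i<n. u i * A (z t) i) + \<rho> t" for t
    by (simp add: \<rho>_def right_diff_distrib sum_subtractf)
  then have uF: "(\<Sum>i<n. u i * F (z t) i) = - (\<Sum>j<k. b j * y j t) + \<rho> t" for t
    using normal_form_left_eigenvector[OF k H(1) u(2), of L gc hc "z t"] by (simp add: A_def b_def y_def)
  have yk': "(y k' has_real_derivative - (\<Sum>j<k. b j * y j t) + \<rho> t) (at t within {0..})" if "t \<ge> 0" for t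
    using is_solution_derivatives(2)[OF z(1)[unfolded k'] that, of u] unfolding uF by (simp add: y_def)
  have w': "(w has_vector_derivative s * w t + of_real (\<rho> t)) (at t within {0..})" if "t \<ge> 0" for t
  proof -
    have "w = (\<lambda>t. (\<Sum>j<k'. coeff q j * complex_of_real (y j t)) + coeff q k' * complex_of_real (y k' t))"
      by (simp add: w_def k')
    moreover have "((\<lambda>t. (\<Sum>j<k'. coeff q j * complex_of_real (y j t)) + coeff q k' * complex_of_real (y k' t))
        has_vector_derivative (\<Sum>j<k'. coeff q j * complex_of_real (y (Suc j) t))
          + coeff q k' * complex_of_real (- (\<Sum>j<k. b j * y j t) + \<rho> t)) (at t within {0..})"
      using y' yk' that
      by (intro has_vector_derivative_add has_vector_derivative_sum has_vector_derivative_mult_right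
          has_vector_derivative_of_real) auto
    \<comment> \<open>The recursion for the coefficients of \<open>q\<close> turns
      \<open>s * w t\<close> into the derivative of \<open>w\<close> without its remainder
      \<open>\<rho> t\<close>.\<close>
    moreover have sw: "s * w t = (\<Sum>j<k'. coeff q j * complex_of_real (y (Suc j) t)) - of_real (\<Sum>j<k. b j * y j t)"
    proof -
      have "s * w t = (\<Sum>j<k. s * coeff q j * complex_of_real (y j t))"
        by (simp add: w_def sum_distrib_left mult_ac)
      also have "\<dots> = - of_real (b 0 * y 0 t)
          + (\<Sum>j<k'. (coeff q j - of_real (b (Suc j))) * complex_of_real (y (Suc j) t))"
        unfolding k' sum.lessThan_Suc_shift using q_0 q_Suc by (simp add: k')
      also have "\<dots> = (\<Sum>j<k'. coeff q j * complex_of_real (y (Suc j) t))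
          - (of_real (b 0 * y 0 t) + (\<Sum>j<k'. of_real (b (Suc j) * y (Suc j) t)))"
        by (simp add: left_diff_distrib sum_subtractf)
      also have "of_real (b 0 * y 0 t) + (\<Sum>j<k'. of_real (b (Suc j) * y (Suc j) t))
          = complex_of_real (\<Sum>j<k. b j * y j t)"
        unfolding k' sum.lessThan_Suc_shift by simp
      finally show ?thesis .
    qed
    ultimately show ?thesis
      unfolding sw by (simp add: q_k' add_diff_eq diff_add_eq)
  qed
  have \<rho>: "norm (complex_of_real (\<rho> t)) \<le> N * (\<eta> * (c * (\<epsilon> * N))) * exp (- a * t)" if t: "t \<ge> 0" for t
  proof -
    have "exp (- a * t) \<le> 1" using a t by simp
    then have "c * (\<epsilon> * N) * exp (- a * t) \<le> c * (\<epsilon> * N) * 1"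
      using c \<epsilon> N by (intro mult_left_mono) auto
    then have "vnorm I (z t) < \<delta>" using zb[OF t] \<epsilon>N(2) by linarith
    define R where "R = (\<lambda>i. F (z t) i - F (\<lambda>_. 0) i - A (z t) i)"
    have "\<bar>\<rho> t\<bar> = \<bar>\<Sum>i<n. u i * R i\<bar>" by (simp add: \<rho>_def R_def F0)
    also have "\<dots> \<le> (\<Sum>i<n. \<bar>u i\<bar> * \<bar>R i\<bar>)"
      by (rule order.trans[OF sum_abs]) (simp add: abs_mult)
    also have "\<dots> \<le> N * vnorm {..<n} R"
      unfolding N_def vnorm_def by (rule L2_set_mult_ineq)
    also have "\<dots> \<le> N * (\<eta> * (c * (\<epsilon> * N) * exp (- a * t)))"
    proof (rule mult_left_mono)
      have "vnorm {..<n} R \<le> \<eta> * vnorm I (z t)"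
        unfolding R_def by (rule rem[OF zs[OF t] \<open>vnorm I (z t) < \<delta>\<close>])
      also have "\<dots> \<le> \<eta> * (c * (\<epsilon> * N) * exp (- a * t))"
        using zb[OF t] \<eta> by (intro mult_left_mono) simp_all
      finally show "vnorm {..<n} R \<le> \<eta> * (c * (\<epsilon> * N) * exp (- a * t))" .
    qed (use N in simp)
    finally show ?thesis by (simp only: norm_of_real mult.assoc)
  qed
  \<comment> \<open>A crude constant suffices: only the exponential rate of \<open>w\<close> is
    used, and the constant does not appear in the conclusion of
    \<open>norm_initial_le_of_perturbed_decay\<close>.\<close>
  define U where "U = (\<Sum>i<n. \<bar>u i\<bar>)"
  have wb: "norm (w t) \<le> (\<Sum>j<k. norm (coeff q j) * U) * (c * (\<epsilon> * N)) * exp (- a * t)"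
    if t: "t \<ge> 0" for t
  proof -
    have "\<bar>y j t\<bar> \<le> U * (c * (\<epsilon> * N) * exp (- a * t))" if "j < k" for j
    proof -
      have "\<bar>z t (j, i)\<bar> \<le> c * (\<epsilon> * N) * exp (- a * t)" if "i < n" for i
      proof -
        have "\<bar>z t (j, i)\<bar> \<le> L2_set (\<lambda>x. \<bar>z t x\<bar>) I"
          using \<open>i < n\<close> \<open>j < k\<close> by (intro member_le_L2_set) (auto simp: I_def)
        also have "\<dots> = vnorm I (z t)" by (simp add: vnorm_def L2_set_def)
        finally show ?thesis using zb[OF t] by linarith
      qed
      then have "(\<Sum>i<n. \<bar>u i * z t (j, i)\<bar>) \<le> (\<Sum>i<n. \<bar>u i\<bar> * (c * (\<epsilon> * N) * exp (- a * t)))"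
        unfolding abs_mult by (intro sum_mono mult_left_mono) auto
      then show ?thesis unfolding y_def U_def sum_distrib_right by (rule order.trans[OF sum_abs])
    qed
    then have "norm (w t) \<le> (\<Sum>j<k. norm (coeff q j) * (U * (c * (\<epsilon> * N) * exp (- a * t))))"
      unfolding w_def
      by (intro sum_norm_le) (simp only: norm_mult norm_of_real lessThan_iff mult_left_mono norm_ge_zero)
    then show ?thesis by (simp only: sum_distrib_right mult.assoc)
  qed
  have "norm (w 0) \<le> N * (\<eta> * (c * (\<epsilon> * N))) / (a + Re s)"
    using norm_initial_le_of_perturbed_decay[OF \<sigma>[unfolded \<sigma>_def] w' \<rho> wb] .
  also have "\<dots> = \<epsilon> * (N * N) / 2"
    using \<sigma> c unfolding \<sigma>_def[symmetric] \<eta>_def by (simp add: field_simps)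
  finally have "norm (w 0) \<le> \<epsilon> * (N * N) / 2" .
  moreover have "y j 0 = (if j = k' then \<epsilon> * (N * N) else 0)" for j
    by (simp add: y_def z(2) z0_def N2 sum_distrib_left mult_ac)
  then have "w 0 = complex_of_real (\<epsilon> * (N * N))"
    by (simp add: w_def k' q_k')
  then have "norm (w 0) = \<epsilon> * (N * N)" using \<epsilon> N by (simp only: norm_of_real) simp
  moreover have "\<epsilon> * (N * N) > 0" using \<epsilon> N by simp
  ultimately show False by linarith
qed

section \<open>Passage to the worst-case convergence rate\<close>

lemma conv_rate_gt_imp_Re_root_less:
  assumes "k \<ge> 1" "H \<in> carrier_mat n n" "l \<in> spectrum H"
    and "linearization n k F (normal_form k L gc hc H)"
    and "ereal a < conv_rate n k F" "char_fun k gc hc (l / L) s = 0"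
  shows "Re s < - a"
proof -
  \<comment> \<open>The supremum need not be attained, so an admissible rate strictly above
    \<open>a\<close> is taken.\<close>
  obtain b where "b \<ge> 0" "exp_bound n k F b" "a < b"
    using assms(5) unfolding conv_rate_def less_Sup_iff by auto
  then show ?thesis
    using exp_bound_imp_Re_root_le[OF assms(1) \<open>b \<ge> 0\<close> assms(2,3) _ assms(4,6)] by force
qed

theorem proposition3p2:
  fixes k :: nat and B :: real
  assumes "k \<ge> 2" and "B > 0"
  shows "\<exists>C>0. \<forall>(n::nat) (\<mu>::real) (L::real) (\<kappa>::real) \<F> g h (gc :: nat \<Rightarrow> real) (hc :: nat \<Rightarrow> real).
           n \<ge> 1 \<longrightarrow> 0 < \<mu> \<longrightarrow> \<mu> \<le> L \<longrightarrow> \<kappa> = L / \<mu> \<longrightarrow>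
           function_class n \<mu> L \<F> \<longrightarrow>
           (g, h) \<in> normalized_algorithms n k L \<F> \<longrightarrow>
           has_normal_form n k L \<F> (g, h) gc hc \<longrightarrow>
           (\<forall>l\<in>{1 / \<kappa>..1}. \<forall>s::complex. char_fun k gc hc l s = 0 \<longrightarrow> norm s \<le> B) \<longrightarrow>
           conv_rate_on n k \<F> (g, h) \<le> ereal (C / sqrt \<kappa>)"
proof -
  define D where "D = (real k * (1 + B ^ (k - 1)))\<^sup>2 + (real k ^ 2 + real k) * (1 + (B ^ (k - 1))\<^sup>2)"
  \<comment> \<open>With \<open>a = C / sqrt \<kappa>\<close> the bound
    \<open>\<kappa> * a\<^sup>2 \<le> D ^ k\<close> reads \<open>C\<^sup>2 \<le> D ^ k\<close>,
    which fails because \<open>C\<^sup>2 \<ge> C > D ^ k\<close>.\<close>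
  define C where "C = D ^ k + 1"
  have "D \<ge> 0" by (simp add: D_def)
  then have C: "C \<ge> 1" "D ^ k < C" by (auto simp: C_def)
  have "conv_rate_on n k \<F> (g, h) \<le> ereal (C / sqrt \<kappa>)"
    if \<mu>: "0 < \<mu>" "\<mu> \<le> L" and \<kappa>: "\<kappa> = L / \<mu>" and \<F>: "function_class n \<mu> L \<F>"
      and nf: "has_normal_form n k L \<F> (g, h) gc hc"
      and roots: "\<forall>l\<in>{1 / \<kappa>..1}. \<forall>s. char_fun k gc hc l s = 0 \<longrightarrow> norm s \<le> B"
    for n \<mu> L \<kappa> \<F> g h gc hc
  proof (rule ccontr)
    define a where "a = C / sqrt \<kappa>"
    have "\<kappa> \<ge> 1" using \<mu> by (simp add: \<kappa>)
    then have a: "a > 0" using C by (simp add: a_def)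
    assume "\<not> conv_rate_on n k \<F> (g, h) \<le> ereal (C / sqrt \<kappa>)"
    then have rate: "ereal a < conv_rate n k (closed_loop n (g, h) f)" if "f \<in> \<F>" for f
      using that unfolding conv_rate_on_def a_def by (meson INF_lower not_le order.strict_trans2)
    have "norm s \<le> B \<and> Re s \<le> - a" if l: "l \<in> {1 / \<kappa>..1}" and s: "char_fun k gc hc l s = 0" for l s
    proof
      show "norm s \<le> B" using roots l s by blast
      \<comment> \<open>Each \<lambda> is tested on its own function: some member of the class has
        the eigenvalue \<open>l * L\<close>, and the rate exceeds \<open>a\<close> for all
        members.\<close>
      have "l * L \<in> {\<mu>..L}" using l \<mu> by (simp add: \<kappa> field_simps)
      then obtain f where f: "f \<in> \<F>" "l * L \<in> spectrum (hessian n f (\<lambda>_. 0))"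
        using \<F> unfolding function_class_def by blast
      have "char_fun k gc hc (l * L / L) s = 0" using s \<mu> by simp
      with conv_rate_gt_imp_Re_root_less[OF _ _ f(2) _ rate[OF f(1)]] f(1) nf assms(1)
      show "Re s \<le> - a" unfolding has_normal_form_def by (force simp: hessian_def)
    qed
    then have "\<kappa> * a\<^sup>2 \<le> D ^ k"
      unfolding D_def using \<open>\<kappa> \<ge> 1\<close> a assms by (intro decay_rate_bound) auto
    moreover have "\<kappa> * a\<^sup>2 = C\<^sup>2" using \<open>\<kappa> \<ge> 1\<close> by (simp add: a_def power_divide)
    moreover have "C \<le> C\<^sup>2" using C by (simp add: self_le_power)
    ultimately show False using C by linarith
  qed
  moreover have "C > 0" using C by linarith
  ultimately show ?thesis by blast
qed

end
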